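(* (i) Every ABA-free hypergraph has chromatic number at most $3$; (ii) every pseudohalfplane hypergraph has chromatic number at most $4$; (iii) every dual pseudohalfplane hypergraph has chromatic number at most $3$. Moreover these bounds are best possible: there exist an ABA-free hypergraph and a dual pseudohalfplane hypergraph with chromatic number $3$, and a pseudohalfplane hypergraph with chromatic number $4$.
   Context: A hypergraph $\mathcal{F}$ on a totally ordered finite vertex set $V$ (a family of subsets of $V$) is ABA-free if there are no two hyperedges $A,B\in\mathcal{F}$ and vertices $x<y<z$ with $x,z\in A\setminus B$ and $y\in B\setminus A$. For a family $\mathcal{F}$ of subsets of $V$ let $\bar{\mathcal{F}}=\{V\setminus F: F\in\mathcal{F}\}$. A hypergraph $\mathcal{H}$ on $V$ is a pseudohalfplane hypergraph if there exists an ABA-free hypergraph $\mathcal{F}$ on $V$ such that $\mathcal{H}\subseteq\mathcal{F}\cup\bar{\mathcal{F}}$. The dual of a hypergraph $\mathcal{H}$ is the hypergraph whose vertices are the hyperedges of $\mathcal{H}$ and which has, for each vertex $v$ of $\mathcal{H}$, the hyperedge $\{H\in\mathcal{H}: v\in H\}$; a dual pseudohalfplane hypergraph is a hypergraph isomorphic to the dual of a pseudohalfplane hypergraph. A proper $k$-coloring of a hypergraph assigns one of $k$ colors to each vertex so that no hyperedge with at least two vertices is monochromatic; the chromatic number is the least such $k$. *)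

theory Defs
  imports Main
begin

text \<open>A hypergraph is a pair of a vertex set and a family of hyperedges. The total order on the
  vertices, where one is needed, is that of the class \<^class>\<open>linorder\<close>.\<close>

type_synonym 'a hypergraph = "'a set \<times> 'a set set"

abbreviation verts :: "'a hypergraph \<Rightarrow> 'a set" where
  "verts G \<equiv> fst G"

abbreviation hyperedges :: "'a hypergraph \<Rightarrow> 'a set set" where
  "hyperedges G \<equiv> snd G"

definition hypergraph :: "'a hypergraph \<Rightarrow> bool" where
  "hypergraph G \<longleftrightarrow> finite (verts G) \<and> hyperedges G \<subseteq> Pow (verts G)"

definition ABA_free :: "'a::linorder hypergraph \<Rightarrow> bool" where
  "ABA_free G \<longleftrightarrow> hypergraph G \<and>
     \<not> (\<exists>A \<in> hyperedges G. \<exists>B \<in> hyperedges G. \<exists>x y z. x < y \<and> y < z \<and>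
          x \<in> A - B \<and> z \<in> A - B \<and> y \<in> B - A)"

definition complement_family :: "'a set \<Rightarrow> 'a set set \<Rightarrow> 'a set set" where
  "complement_family V F = {V - A | A. A \<in> F}"

definition pseudohalfplane_hypergraph :: "'a::linorder hypergraph \<Rightarrow> bool" where
  "pseudohalfplane_hypergraph G \<longleftrightarrow>
     (\<exists>F. ABA_free (verts G, F) \<and> hyperedges G \<subseteq> F \<union> complement_family (verts G) F)"

definition dual_hypergraph :: "'a hypergraph \<Rightarrow> 'a set hypergraph" where
  "dual_hypergraph G =
     (hyperedges G, {{H \<in> hyperedges G. v \<in> H} | v. v \<in> verts G})"

definition hypergraph_isomorphic :: "'a hypergraph \<Rightarrow> 'b hypergraph \<Rightarrow> bool" where
  "hypergraph_isomorphic G G' \<longleftrightarrow> hypergraph G \<and> hypergraph G' \<and>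
     (\<exists>f. bij_betw f (verts G) (verts G') \<and> hyperedges G' = (\<lambda>E. f ` E) ` hyperedges G)"

text \<open>The vertex type of the primal hypergraph does not occur in the type of the dual one up to
  isomorphism, so it is passed as a type argument.\<close>

definition dual_pseudohalfplane_hypergraph ::
    "'a::linorder itself \<Rightarrow> 'b hypergraph \<Rightarrow> bool" where
  "dual_pseudohalfplane_hypergraph TYPE('a) G \<longleftrightarrow>
     (\<exists>P :: 'a hypergraph. pseudohalfplane_hypergraph P \<and>
        hypergraph_isomorphic G (dual_hypergraph P))"

definition proper_coloring :: "nat \<Rightarrow> 'a hypergraph \<Rightarrow> ('a \<Rightarrow> nat) \<Rightarrow> bool" where
  "proper_coloring k G c \<longleftrightarrow> c ` verts G \<subseteq> {..<k} \<and>
     (\<forall>E \<in> hyperedges G. 2 \<le> card E \<longrightarrow> \<not> (\<exists>i. \<forall>v \<in> E. c v = i))"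

text \<open>For a hypergraph on a finite vertex set an injective coloring is proper, so the minimum below
  exists.\<close>

definition chromatic_number :: "'a hypergraph \<Rightarrow> nat" where
  "chromatic_number G = (LEAST k. \<exists>c. proper_coloring k G c)"

end

theory Submission imports Defs begin

text \<open>
  Call a vertex unskipped if every hyperedge that has vertices on both sides of it contains it.
  In an ABA-free family every nonempty hyperedge contains an unskipped vertex, and it meets the set
  of unskipped vertices in an interval of that set. Two alternating colors on the unskipped vertices
  and a third color elsewhere give (i). For (ii) the unskipped vertices of the family and those of
  the complementary family together form a cycle, met by every hyperedge in an arc; three colors
  suffice for a cycle, and the fourth is used off the cycle.

  For (iii), a set \<open>T \<subseteq> X \<union> Y\<close> can be removed and later be given a color different from those of
  \<open>X\<close> and \<open>Y\<close>. When no set is contained in the union of two others, the sets form a cycle on which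
  the sets that contain a given point include two neighbours as soon as there are two of them.
\<close>

section \<open>Ranks and intervals in finite linear orders\<close>

definition rank :: "'a set \<Rightarrow> ('a \<Rightarrow> 'a \<Rightarrow> bool) \<Rightarrow> 'a \<Rightarrow> nat" where
  "rank S r x = card {y \<in> S. r x y}"

text \<open>Ranks count from the top, so two chains that are joined at their greatest elements both
  start with rank 0 there. This is what makes the colors at the joint of a cycle computable.\<close>

lemma rank_greatest: "(\<And>y. y \<in> S \<Longrightarrow> \<not> r x y) \<Longrightarrow> rank S r x = 0"
  unfolding rank_def by (metis (no_types, lifting) Collect_empty_eq card.empty)

lemma rank_less:
  assumes "finite S" "transp_on S r" "asymp_on S r" "x \<in> S" "y \<in> S" "r x y"
  shows "rank S r y < rank S r x"
proof -
  have "{z \<in> S. r y z} \<subset> {z \<in> S. r x z}"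
    using assms by (auto dest: transp_onD asymp_onD)
  then show ?thesis
    unfolding rank_def using assms(1) by (intro psubset_card_mono) auto
qed

text \<open>The two elements of \<open>E\<close> of lowest rank are its two greatest elements. By
  convexity no element of \<open>S\<close> lies strictly between them, so their ranks are
  consecutive numbers.\<close>

lemma interval_rank_parity:
  assumes fin: "finite S" and tr: "transp_on S r" and as: "asymp_on S r" and tot: "totalp_on S r"
    and sub: "E \<subseteq> S" and card: "2 \<le> card E"
    and conv: "\<And>x y z. x \<in> E \<Longrightarrow> z \<in> E \<Longrightarrow> y \<in> S \<Longrightarrow> r x y \<Longrightarrow> r y z \<Longrightarrow> y \<in> E"
  shows "\<exists>x\<in>E. \<exists>y\<in>E. rank S r x mod 2 \<noteq> rank S r y mod 2"
proof -
  have finE: "finite E"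
    using fin sub by (rule rev_finite_subset)
  have "E \<noteq> {}"
    using card by auto
  then obtain x where x: "x \<in> E" and xmin: "\<And>u. u \<in> E \<Longrightarrow> rank S r x \<le> rank S r u"
    using ex_min_if_finite[of "rank S r ` E"] finE by (auto simp: not_less)
  have "E - {x} \<noteq> {}"
    using card by (metis card.empty card_Suc_Diff1 finE x not_less_eq_eq numeral_2_eq_2 order_refl)
  then obtain y where y: "y \<in> E - {x}" and ymin: "\<And>u. u \<in> E - {x} \<Longrightarrow> rank S r y \<le> rank S r u"
    using ex_min_if_finite[of "rank S r ` (E - {x})"] finE by (auto simp: not_less)
  have lt: "rank S r u < rank S r w" if "r w u" "w \<in> S" "u \<in> S" for u w
    using rank_less[OF fin tr as] that by blast
  have xS: "x \<in> S" "y \<in> S" "y \<noteq> x"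
    using x y sub by auto
  have ryx: "r y x"
    using tot xS lt xmin y by (metis DiffD1 not_le totalp_onD)
  have "{u \<in> S. r y u} = insert x {u \<in> S. r x u}"
  proof (intro set_eqI iffI)
    fix u assume u: "u \<in> {u \<in> S. r y u}"
    show "u \<in> insert x {u \<in> S. r x u}"
    proof (rule ccontr)
      assume "u \<notin> insert x {u \<in> S. r x u}"
      then have "u \<noteq> x" "r u x"
        using u tot xS by (auto dest: totalp_onD)
      then have "u \<in> E - {x}"
        using conv[of y x u] x y u by auto
      then show False
        using ymin[of u] lt[of y u] u xS by auto
    qed
  next
    fix u assume "u \<in> insert x {u \<in> S. r x u}"
    then show "u \<in> {u \<in> S. r y u}"
      using ryx xS tr by (auto dest: transp_onD)
  qed
  moreover have "x \<notin> {u \<in> S. r x u}"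
    using as xS by (auto dest: asymp_onD)
  ultimately have "rank S r y = Suc (rank S r x)"
    unfolding rank_def using fin by simp
  then have "rank S r x mod 2 \<noteq> rank S r y mod 2"
    by presburger
  then show ?thesis
    using x y by blast
qed

section \<open>Alternation-free families: complements and deletions\<close>

definition alternation_free :: "'a::linorder set set \<Rightarrow> bool" where
  "alternation_free F \<longleftrightarrow>
     (\<forall>A\<in>F. \<forall>B\<in>F. \<forall>x\<in>A - B. \<forall>y\<in>B - A. \<forall>z\<in>A - B. \<not> (x < y \<and> y < z))"

lemma alternation_freeD:
  assumes "alternation_free F" "A \<in> F" "B \<in> F" "x < y" "y < z"
    "x \<in> A" "x \<notin> B" "z \<in> A" "z \<notin> B" "y \<in> B" "y \<notin> A"
  shows False
  using assms unfolding alternation_free_def by blast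

lemma ABA_free_iff: "ABA_free G \<longleftrightarrow> hypergraph G \<and> alternation_free (hyperedges G)"
  unfolding ABA_free_def alternation_free_def by blast

lemma Diff_complement_family:
  assumes "D \<in> complement_family V F" "F \<subseteq> Pow V"
  shows "V - D \<in> F"
proof -
  obtain A where "A \<in> F" "D = V - A"
    using assms(1) by (auto simp: complement_family_def)
  then show ?thesis
    using assms(2) double_diff[of A V V] by auto
qed

text \<open>For subsets of \<open>V\<close> the difference of the complements of \<open>A\<close>
  and \<open>B\<close> is \<open>B - A\<close>, so an alternation of complements is one of the
  original sets with the roles exchanged.\<close>

lemma alternation_free_complement:
  assumes "alternation_free F" "F \<subseteq> Pow V"
  shows "alternation_free (complement_family V F)"
  using assms unfolding alternation_free_def complement_family_def by blast

lemma alternation_free_delete: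
  "alternation_free F \<Longrightarrow> alternation_free ((\<lambda>B. B - {v}) ` F)"
  unfolding alternation_free_def by blast

subsection \<open>Unskipped vertices\<close>

definition unskipped :: "'a::linorder set set \<Rightarrow> 'a \<Rightarrow> bool" where
  "unskipped F v \<longleftrightarrow> (\<forall>B\<in>F. \<forall>x\<in>B. \<forall>z\<in>B. x < v \<longrightarrow> v < z \<longrightarrow> v \<in> B)"

lemma unskippedD:
  "unskipped F v \<Longrightarrow> B \<in> F \<Longrightarrow> x \<in> B \<Longrightarrow> z \<in> B \<Longrightarrow> x < v \<Longrightarrow> v < z \<Longrightarrow> v \<in> B"
  unfolding unskipped_def by blast

text \<open>If a set \<open>B\<close> skips \<open>w\<close> only thanks to \<open>v\<close>, then
  \<open>v\<close> is the only element of \<open>B\<close> on its side of \<open>w\<close>. A set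
  \<open>C\<close> that skips \<open>v\<close> has elements on both sides of \<open>v\<close>, and
  these, possibly with \<open>w\<close> in place of one of them, lie outside \<open>B\<close>. So
  \<open>C\<close> and \<open>B\<close> alternate around \<open>v\<close>.\<close>

lemma unskipped_undelete:
  assumes af: "alternation_free F" and v: "\<not> unskipped F v" and "w \<noteq> v"
    and w: "unskipped ((\<lambda>B. B - {v}) ` F) w"
  shows "unskipped F w"
  unfolding unskipped_def
proof (intro ballI impI, rule ccontr)
  fix B x z assume B: "B \<in> F" "x \<in> B" "z \<in> B" "x < w" "w < z" "w \<notin> B"
  have w': "w \<in> D" if "D \<in> F" "s \<in> D" "t \<in> D" "s \<noteq> v" "t \<noteq> v" "s < w" "w < t" for D s t
    using unskippedD[OF w, of "D - {v}" s t] that by auto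
  obtain C s t where C: "C \<in> F" "s \<in> C" "t \<in> C" "s < v" "v < t" "v \<notin> C"
    using v unfolding unskipped_def by blast
  have st: "s \<noteq> v" "t \<noteq> v"
    using C by auto
  \<comment> \<open>Otherwise \<open>B - {v}\<close> would still skip \<open>w\<close>. The two
    cases are mirror images.\<close>
  consider "x = v" | "z = v"
    using w'[of B x z] B by blast
  then show False
  proof cases
    case 1
    have "z \<noteq> v"
      using B 1 by (metis less_asym)
    then have below: "u \<notin> B" if "u < w" "u \<noteq> v" for u
      using w'[of B u z] that 1 B by auto
    have "w \<in> C"
    proof (rule ccontr)
      assume "w \<notin> C"
      then have "t < w"
        using w'[of C s t] C st B 1 by (metis less_trans linorder_neqE)
      then show False
        using alternation_freeD[OF af C(1) B(1) C(4,5)] below C B 1 by fastforce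
    qed
    then show False
      using alternation_freeD[OF af C(1) B(1) C(4), of w] below[of s] C B 1 by fastforce
  next
    case 2
    have "x \<noteq> v"
      using B 2 by (metis less_asym)
    then have above: "u \<notin> B" if "w < u" "u \<noteq> v" for u
      using w'[of B x u] that 2 B by auto
    have "w \<in> C"
    proof (rule ccontr)
      assume "w \<notin> C"
      then have "w < s"
        using w'[of C s t] C st B 2 by (metis less_trans linorder_neqE)
      then show False
        using alternation_freeD[OF af C(1) B(1) C(4,5)] above C B 2 by fastforce
    qed
    then show False
      using alternation_freeD[OF af C(1) B(1), of w v t] above[of t] C B 2 by fastforce
  qed
qed

text \<open>A skipped vertex \<open>v\<close> of \<open>A\<close> is deleted from all sets of the
  family. The smaller set has an unskipped vertex by induction, and putting \<open>v\<close> back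
  does not make that vertex skipped.\<close>

lemma exists_unskipped:
  assumes "alternation_free F" "A \<in> F" "finite A" "A \<noteq> {}"
  shows "\<exists>a\<in>A. unskipped F a"
  using assms
proof (induction "card A" arbitrary: A F rule: less_induct)
  case less
  obtain v where v: "v \<in> A"
    using less.prems by auto
  show ?case
  proof (cases "unskipped F v")
    case False
    then obtain B x z where B: "B \<in> F" "x \<in> B" "z \<in> B" "x < v" "v < z" "v \<notin> B"
      unfolding unskipped_def by blast
    let ?F = "(\<lambda>B. B - {v}) ` F"
    \<comment> \<open>If \<open>A\<close> were \<open>{v}\<close>, then \<open>B\<close>, which
      skips \<open>v\<close>, would alternate with \<open>A\<close> in \<open>x\<close>,
      \<open>v\<close>, \<open>z\<close>.\<close>
    have "A - {v} \<noteq> {}"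
      using alternation_freeD[OF less.prems(1) B(1) less.prems(2) B(4,5)] B v by auto
    moreover have "card (A - {v}) < card A"
      using less.prems(3) v by (rule card_Diff1_less)
    ultimately obtain w where "w \<in> A - {v}" "unskipped ?F w"
      using less.hyps[of "A - {v}" ?F] less.prems alternation_free_delete by auto
    then show ?thesis
      using unskipped_undelete[OF less.prems(1) False] by auto
  qed (use v in blast)
qed

lemma ABA_free_proper_coloring:
  assumes "ABA_free G"
  shows "\<exists>c. proper_coloring 3 G c"
proof -
  obtain V F where G: "G = (V, F)"
    by fastforce
  have af: "alternation_free F" and FV: "F \<subseteq> Pow V" and fin: "finite V"
    using assms G by (auto simp: ABA_free_iff hypergraph_def)
  define U where "U = {v \<in> V. unskipped F v}"
  define c where "c v = (if v \<in> U then rank U (<) v mod 2 else 2)" for v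
  have "\<exists>x\<in>E. \<exists>y\<in>E. c x \<noteq> c y" if E: "E \<in> F" "2 \<le> card E" for E
  proof (cases "E \<subseteq> U")
    case True
    \<comment> \<open>An unskipped vertex between two vertices of \<open>E\<close> belongs to
      \<open>E\<close>, so \<open>E\<close> is an interval of \<open>U\<close>.\<close>
    have "\<exists>x\<in>E. \<exists>y\<in>E. rank U (<) x mod 2 \<noteq> rank U (<) y mod 2"
      by (rule interval_rank_parity[OF _ _ _ _ True E(2)])
        (use fin E(1) in \<open>auto simp: U_def dest: unskippedD\<close>)
    then show ?thesis
      using True by (auto simp: c_def subset_iff)
  next
    case False
    have "finite E" "E \<noteq> {}"
      using E FV fin by (auto intro: finite_subset)
    then obtain a where "a \<in> E" "a \<in> U"
      using exists_unskipped[OF af E(1)] E FV by (auto simp: U_def)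
    moreover obtain b where "b \<in> E" "b \<notin> U"
      using False by auto
    ultimately show ?thesis
      by (intro bexI[of _ a] bexI[of _ b]) (auto simp: c_def)
  qed
  then have "proper_coloring 3 G c"
    unfolding proper_coloring_def G by (fastforce simp: c_def)
  then show ?thesis
    by blast
qed

section \<open>Four colors for pseudohalfplane hypergraphs\<close>

lemma unskipped_extreme:
  assumes "F \<subseteq> Pow V" "(\<forall>u\<in>V. v \<le> u) \<or> (\<forall>u\<in>V. u \<le> v)"
  shows "unskipped F v"
  using assms unfolding unskipped_def by (meson PowD leD subsetD)

text \<open>The cycle runs from the least vertex \<open>m\<close> upwards through \<open>U\<close>
  to the greatest vertex \<open>M\<close>, then downwards through \<open>L\<close> back to
  \<open>m\<close>. The cases are whether an edge contains \<open>m\<close>, leaves the cycle,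
  contains \<open>M\<close>, or stays within one of the two chains.\<close>

lemma pseudohalfplane_proper_coloring:
  assumes "pseudohalfplane_hypergraph G"
  shows "\<exists>c. proper_coloring 4 G c"
proof (cases "verts G = {}")
  case True
  then have "hyperedges G \<subseteq> {{}}"
    using assms by (auto simp: pseudohalfplane_hypergraph_def ABA_free_iff hypergraph_def
        complement_family_def)
  with True have "proper_coloring 4 G (\<lambda>_. 0)"
    by (auto simp: proper_coloring_def)
  then show ?thesis
    by blast
next
  case nonempty: False
  obtain V H where G: "G = (V, H)"
    by fastforce
  obtain F where af: "alternation_free F" and FV: "F \<subseteq> Pow V" and fin: "finite V"
    and H: "H \<subseteq> F \<union> complement_family V F"
    using assms G by (auto simp: pseudohalfplane_hypergraph_def ABA_free_iff hypergraph_def)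
  define K where "K = complement_family V F"
  have afK: "alternation_free K"
    unfolding K_def using af FV by (rule alternation_free_complement)
  have KV: "K \<subseteq> Pow V"
    by (auto simp: K_def complement_family_def)
  have FK: "V - E \<in> K" if "E \<in> F" for E
    using that by (auto simp: K_def complement_family_def)
  have KF: "V - E \<in> F" if "E \<in> K" for E
    using that FV unfolding K_def by (rule Diff_complement_family)
  define m where "m = Min V"
  define M where "M = Max V"
  have mM: "m \<in> V" "M \<in> V" "\<And>u. u \<in> V \<Longrightarrow> m \<le> u" "\<And>u. u \<in> V \<Longrightarrow> u \<le> M"
    using fin nonempty by (auto simp: m_def M_def G)
  define U where "U = {v \<in> V. unskipped F v}"
  \<comment> \<open>Vertices unskipped in both families, among them \<open>m\<close> and
    \<open>M\<close>, are counted in \<open>U\<close> only, so that the two chains are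
    disjoint.\<close>
  define L where "L = {v \<in> V. unskipped K v} - U"
  have MU: "M \<in> U"
    using mM unskipped_extreme[OF FV] by (auto simp: U_def)
  have finUL: "finite U" "finite L"
    using fin by (auto simp: U_def L_def)
  \<comment> \<open>The color 2 is reserved for \<open>m\<close>, which closes the cycle whatever
    the parity of its length. The \<open>Suc\<close> separates \<open>M\<close> from the greatest
    vertex of \<open>L\<close>: both have rank 0.\<close>
  define c where "c v = (if v = m then 2 else if v \<in> U then rank U (<) v mod 2
      else if v \<in> L then Suc (rank L (<) v) mod 2 else 3)" for v
  have parity: "\<exists>x\<in>E. \<exists>y\<in>E. c x \<noteq> c y"
    if mE: "m \<notin> E" "X \<subseteq> E" and X: "2 \<le> card X" "X \<subseteq> S" and S: "S = U \<or> S = L"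
      and conv: "\<And>x y z. x \<in> X \<Longrightarrow> z \<in> X \<Longrightarrow> y \<in> S \<Longrightarrow> x < y \<Longrightarrow> y < z \<Longrightarrow> y \<in> X" for E X S
  proof -
    have "finite S"
      using S finUL by auto
    then have "\<exists>x\<in>X. \<exists>y\<in>X. rank S (<) x mod 2 \<noteq> rank S (<) y mod 2"
      by (rule interval_rank_parity[OF _ _ _ _ X(2,1) conv]) auto
    then obtain x y where xy: "x \<in> X" "y \<in> X" "rank S (<) x mod 2 \<noteq> rank S (<) y mod 2"
      by blast
    moreover have "Suc (rank S (<) x) mod 2 \<noteq> Suc (rank S (<) y) mod 2"
      using xy(3) by presburger
    moreover have "S = L \<Longrightarrow> x \<notin> U \<and> y \<notin> U"
      using xy X by (auto simp: L_def)
    ultimately have "c x \<noteq> c y"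
      using xy mE X S by (auto simp: c_def subset_iff)
    then show ?thesis
      using xy mE by blast
  qed
  have "\<exists>x\<in>E. \<exists>y\<in>E. c x \<noteq> c y" if E: "E \<in> F \<union> K" "2 \<le> card E" for E
  proof -
    have EV: "E \<subseteq> V" and finE: "finite E"
      using E FV KV fin by (auto intro: finite_subset)
    have other: "\<exists>b\<in>E. b \<noteq> a" for a
    proof (rule ccontr)
      assume "\<not> ?thesis"
      then have "E \<subseteq> {a}" by auto
      then show False using E(2) card_mono[of "{a}" E] by auto
    qed
    consider "m \<in> E" | "m \<notin> E" "\<not> E \<subseteq> U \<union> L" | "m \<notin> E" "E \<subseteq> U \<union> L" "M \<in> E"
      | "m \<notin> E" "E \<subseteq> U \<union> L" "M \<notin> E"
      by blast
    then show ?thesis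
    proof cases
      case 1
      obtain b where "b \<in> E" "b \<noteq> m"
        using other by blast
      then have "c m \<noteq> c b"
        by (auto simp: c_def)
      then show ?thesis
        using 1 \<open>b \<in> E\<close> by blast
    next
      case 2
      have "\<exists>a\<in>E. unskipped F a \<or> unskipped K a"
        using E exists_unskipped[OF af, of E] exists_unskipped[OF afK, of E] finE by fastforce
      then obtain a where "a \<in> E" "a \<in> U \<union> L"
        using EV by (auto simp: U_def L_def)
      moreover obtain b where "b \<in> E" "b \<notin> U \<union> L"
        using 2 by auto
      ultimately show ?thesis
        using 2 by (intro bexI[of _ a] bexI[of _ b]) (auto simp: c_def)
    next
      case 3
      \<comment> \<open>If \<open>y\<close> were missing, \<open>E\<close> would skip
        \<open>y\<close> between \<open>x\<close> and \<open>M\<close>, and its complement would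
        skip \<open>x\<close> between \<open>m\<close> and \<open>y\<close>. One of these two sets
        lies in the family for which \<open>x\<close> and \<open>y\<close> are unskipped.\<close>
      have up: "y \<in> E" if "x \<in> E" "y \<in> V" "x < y"
        "unskipped F x \<and> unskipped F y \<or> unskipped K x \<and> unskipped K y" for x y
      proof (rule ccontr)
        assume "y \<notin> E"
        then have *: "m < x" "y < M" "m \<in> V - E" "y \<in> V - E" "x \<notin> V - E"
          using that 3 mM EV by (auto simp: order.not_eq_order_implies_strict less_le)
        then show False
          using that E FK KF unskippedD[of F y E x M] unskippedD[of K y E x M]
            unskippedD[of F x "V - E" m y] unskippedD[of K x "V - E" m y] 3 \<open>y \<notin> E\<close> by blast
      qed
      have upS: "y \<in> E" if "x \<in> E" "x \<in> S" "y \<in> S" "x < y" "S = U \<or> S = L" for x y S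
        using up[of x y] that by (auto simp: U_def L_def)
      show ?thesis
      proof (cases "E \<inter> L = {}")
        case True
        then show ?thesis
          using upS[where S = U] 3 by (intro parity[OF 3(1) order_refl E(2), where S = U]) auto
      next
        case False
        \<comment> \<open>The neighbour of \<open>M\<close> on the cycle. Since \<open>E\<close> is
          closed upwards in \<open>L\<close>, it contains \<open>t\<close> as soon as it meets
          \<open>L\<close>.\<close>
        define t where "t = Max L"
        have "L \<noteq> {}"
          using False by blast
        then have t: "t \<in> L" "\<And>u. u \<in> L \<Longrightarrow> u \<le> t"
          using finUL by (simp_all add: t_def)
        have "t \<in> E"
          using t upS[of _ L t] False by (metis disjoint_iff order.not_eq_order_implies_strict)
        have ranks: "rank L (<) t = 0" "rank U (<) M = 0"
          using t(2) mM(4) by (auto intro!: rank_greatest simp: U_def dest: leD)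
        have "c t = 1" "c M = 0"
          using ranks t(1) MU 3 \<open>t \<in> E\<close> by (auto simp: c_def L_def)
        then show ?thesis
          using 3 \<open>t \<in> E\<close> by (metis zero_neq_one)
      qed
    next
      case 4
      have ends: "m \<in> V - E" "M \<in> V - E"
        using mM 4 by auto
      have lt: "m < x" "x < M" if "x \<in> E" for x
        using that mM EV 4 by (auto simp: less_le)
      show ?thesis
      proof (cases "E \<in> F")
        case True
        \<comment> \<open>The complement of \<open>E\<close> contains \<open>m\<close> and
          \<open>M\<close>, hence every vertex that is unskipped for its family
          \<open>K\<close>.\<close>
        then have "x \<notin> L" if "x \<in> E" for x
          using unskippedD[OF _ FK[OF True] ends lt[OF that]] that by (auto simp: L_def)
        then have "E \<subseteq> U"
          using 4 by auto
        then show ?thesis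
          by (rule parity[OF 4(1) order_refl E(2)])
            (use True in \<open>auto simp: U_def dest: unskippedD\<close>)
      next
        case False
        then have EK: "E \<in> K"
          using E by auto
        have "x \<notin> U" if "x \<in> E" for x
          using unskippedD[OF _ KF[OF EK] ends lt[OF that]] that by (auto simp: U_def)
        then have "E \<subseteq> L"
          using 4 by auto
        then show ?thesis
          by (rule parity[OF 4(1) order_refl E(2)])
            (use EK in \<open>auto simp: L_def dest: unskippedD\<close>)
      qed
    qed
  qed
  moreover have "c v < 4" for v
  proof -
    have "n mod 2 < 4" for n :: nat
      by presburger
    then show ?thesis
      by (simp add: c_def)
  qed
  ultimately have "proper_coloring 4 G c"
    unfolding proper_coloring_def G using H K_def by fastforce
  then show ?thesis
    by blast
qed

subsection \<open>Dual pseudohalfplane hypergraphs\<close>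

definition prec :: "'a::linorder set \<Rightarrow> 'a set \<Rightarrow> bool" where
  "prec A B \<longleftrightarrow> (\<exists>x\<in>A - B. \<exists>y\<in>B - A. x < y)"

text \<open>One ordered pair from the two differences decides all of them: if \<open>y\<close> came
  before \<open>x\<close>, then a witness pair \<open>s < t\<close> would give the alternation
  \<open>s < y < x\<close> or \<open>y < s < t\<close>.\<close>

lemma precD:
  assumes af: "alternation_free F" and AB: "A \<in> F" "B \<in> F" "prec A B"
    and x: "x \<in> A" "x \<notin> B" and y: "y \<in> B" "y \<notin> A"
  shows "x < y"
proof (rule ccontr)
  assume "\<not> x < y"
  then have yx: "y < x"
    using x y by (metis linorder_neqE)
  obtain s t where st: "s \<in> A" "s \<notin> B" "t \<in> B" "t \<notin> A" "s < t"
    using AB(3) unfolding prec_def by blast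
  have "s < y \<or> y < s"
    using st y by (metis linorder_neqE)
  then show False
  proof
    assume "s < y"
    then show False
      using alternation_freeD[OF af AB(1,2) _ yx] st x y by blast
  next
    assume "y < s"
    then show False
      using alternation_freeD[OF af AB(2,1) _ st(5)] st x y by blast
  qed
qed

text \<open>The case \<open>X = Y\<close> is included, so distinct sets are also incomparable. Of
  any three distinct sets, each has a private point outside the other two.\<close>

definition irredundant :: "'a set set \<Rightarrow> bool" where
  "irredundant H \<longleftrightarrow> (\<forall>T\<in>H. \<forall>X\<in>H - {T}. \<forall>Y\<in>H - {T}. \<not> T \<subseteq> X \<union> Y)"

lemma irredundantE:
  assumes "irredundant H" "T \<in> H" "X \<in> H" "Y \<in> H" "X \<noteq> T" "Y \<noteq> T"
  obtains p where "p \<in> T" "p \<notin> X" "p \<notin> Y"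
  using assms unfolding irredundant_def by blast

context
  fixes S :: "'a::linorder set set"
  assumes af: "alternation_free S" and irr: "irredundant S"
begin

lemma prec_asymp_on: "asymp_on S prec"
proof (rule asymp_onI)
  fix A B assume *: "A \<in> S" "B \<in> S" "prec A B"
  then obtain x y where "x \<in> A - B" "y \<in> B - A" "x < y"
    unfolding prec_def by blast
  then show "\<not> prec B A"
    using precD[OF af *(2,1)] by (meson DiffD1 DiffD2 less_asym)
qed

lemma prec_totalp_on: "totalp_on S prec"
proof (rule totalp_onI)
  fix A B assume "A \<in> S" "B \<in> S" "A \<noteq> B"
  then obtain a b where "a \<in> A - B" "b \<in> B - A"
    using irr by (metis DiffI irredundantE)
  then show "prec A B \<or> prec B A"
    unfolding prec_def by (metis DiffD1 DiffD2 linorder_neqE)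
qed

text \<open>Private points of \<open>A\<close>, \<open>B\<close> and \<open>C\<close> are ordered
  like the sets, and those of \<open>A\<close> and \<open>C\<close> witness the conclusion.\<close>

lemma prec_transp_on: "transp_on S prec"
proof (rule transp_onI)
  fix A B C assume *: "A \<in> S" "B \<in> S" "C \<in> S" "prec A B" "prec B C"
  then have ne: "A \<noteq> B" "B \<noteq> C" "A \<noteq> C"
    using prec_asymp_on by (auto dest: asymp_onD)
  obtain p where p: "p \<in> B" "p \<notin> A" "p \<notin> C"
    using irredundantE[OF irr, of B A C] * ne by metis
  obtain q where q: "q \<in> A" "q \<notin> B" "q \<notin> C"
    using irredundantE[OF irr, of A B C] * ne by metis
  obtain s where s: "s \<in> C" "s \<notin> A" "s \<notin> B"
    using irredundantE[OF irr, of C A B] * ne by metis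
  have "q < p" "p < s"
    using precD[OF af] * p q s by blast+
  then have "q < s" by simp
  then show "prec A C"
    unfolding prec_def using q s by blast
qed

text \<open>If \<open>v\<close> were missing from \<open>B\<close>, a private point of
  \<open>B\<close> would lie after \<open>v\<close> because of \<open>A\<close> and before
  \<open>v\<close> because of \<open>C\<close>.\<close>

lemma prec_between:
  assumes *: "A \<in> S" "B \<in> S" "C \<in> S" "prec A B" "prec B C" and v: "v \<in> A" "v \<in> C"
  shows "v \<in> B"
proof (rule ccontr)
  assume "v \<notin> B"
  have "A \<noteq> B" "C \<noteq> B"
    using * prec_asymp_on by (auto dest: asymp_onD)
  then obtain p where p: "p \<in> B" "p \<notin> A" "p \<notin> C"
    using irredundantE[OF irr, of B A C] * by metis
  have "v < p" "p < v"
    using precD[OF af] * p v \<open>v \<notin> B\<close> by blast+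
  then show False by simp
qed

lemma prec_rank_parity:
  assumes "finite S" "2 \<le> card {X \<in> S. v \<in> X}"
  shows "\<exists>X\<in>S. \<exists>Y\<in>S. v \<in> X \<and> v \<in> Y \<and> rank S prec X mod 2 \<noteq> rank S prec Y mod 2"
proof -
  have "\<exists>X\<in>{X \<in> S. v \<in> X}. \<exists>Y\<in>{X \<in> S. v \<in> X}. rank S prec X mod 2 \<noteq> rank S prec Y mod 2"
    by (rule interval_rank_parity[OF assms(1) prec_transp_on prec_asymp_on prec_totalp_on _ assms(2)])
      (auto intro: prec_between)
  then show ?thesis
    by blast
qed

end

lemma irredundant_subset: "irredundant H \<Longrightarrow> S \<subseteq> H \<Longrightarrow> irredundant S"
  unfolding irredundant_def by blast

lemma alternation_free_subset: "alternation_free F \<Longrightarrow> S \<subseteq> F \<Longrightarrow> alternation_free S"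
  unfolding alternation_free_def by blast

text \<open>\<open>P\<close> is the upper and \<open>N\<close> the lower halfplanes. In the cyclic order, \<open>P\<close> increasing with respect
  to \<^const>\<open>prec\<close> is followed by \<open>N\<close> decreasing, so the greatest elements of \<open>P\<close> and \<open>N\<close> are
  neighbours, as are the least ones.\<close>

lemma irredundant_coloring:
  assumes af: "alternation_free F" and FV: "F \<subseteq> Pow V" and finH: "finite H"
    and H: "H \<subseteq> F \<union> complement_family V F" and irr: "irredundant H"
  shows "\<exists>c. c ` H \<subseteq> {..<3::nat} \<and>
    (\<forall>v\<in>V. 2 \<le> card {X \<in> H. v \<in> X} \<longrightarrow> (\<exists>X\<in>H. \<exists>Y\<in>H. v \<in> X \<and> v \<in> Y \<and> c X \<noteq> c Y))"
proof -
  define P where "P = H \<inter> F"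
  define N where "N = H - F"
  have HPN: "H = P \<union> N" "P \<inter> N = {}"
    by (auto simp: P_def N_def)
  have fin: "finite P" "finite N"
    using finH by (auto simp: P_def N_def)
  have afP: "alternation_free P"
    using af by (rule alternation_free_subset) (auto simp: P_def)
  have afN: "alternation_free N"
    using alternation_free_complement[OF af FV] by (rule alternation_free_subset) (use H in \<open>auto simp: N_def\<close>)
  have NF: "V - D \<in> F" if "D \<in> N" for D
    using that H by (intro Diff_complement_family[OF _ FV]) (auto simp: N_def)
  have HV: "X \<subseteq> V" if "X \<in> H" for X
    using that H FV by (auto simp: complement_family_def)
  have irrP: "irredundant P" and irrN: "irredundant N"
    using irr HPN by (auto intro: irredundant_subset)
  define least where "least X \<longleftrightarrow> X \<in> P \<and> (\<forall>Y\<in>P. \<not> prec Y X)" for X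
  have least_unique: "X = Y" if "least X" "least Y" for X Y
    using that prec_totalp_on[OF afP irrP] unfolding least_def totalp_on_def by blast
  \<comment> \<open>As for vertices, color 2 on the least set of \<open>P\<close> absorbs the parity
    of the cycle, and \<open>Suc\<close> separates the greatest sets of \<open>P\<close> and
    \<open>N\<close>.\<close>
  define c where "c X = (if least X then 2 else if X \<in> P then rank P prec X mod 2
      else Suc (rank N prec X) mod 2)" for X
  \<comment> \<open>A point in just one set of each kind forces these sets to meet at the top joint
    of the cycle. A predecessor of \<open>A\<close> has a point to the left of \<open>v\<close>
    outside \<open>A\<close> and \<open>D\<close>; a successor of \<open>A\<close> or
    \<open>D\<close> would have one to the right.\<close>
  have greatest: "(\<forall>Y\<in>P. \<not> prec A Y) \<and> (\<forall>Y\<in>N. \<not> prec D Y)"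
    if v: "v \<in> V" and AD: "{X \<in> H. v \<in> X} = {A, D}" "A \<in> P" "D \<in> N" and nl: "\<not> least A" for v A D
  proof -
    obtain A' where A': "A' \<in> P" "prec A' A"
      using AD nl unfolding least_def by blast
    have vn: "v \<notin> X" if "X \<in> H" "X \<noteq> A" "X \<noteq> D" for X
      using AD(1) that by blast
    have neq: "A \<noteq> D" "A \<noteq> A'" "A' \<noteq> D"
      using AD A' HPN prec_asymp_on[OF afP irrP] by (auto dest: asymp_onD)
    have A'H: "A' \<in> H" "A \<in> H" "D \<in> H"
      using A' AD HPN by auto
    note vA' = vn[OF A'H(1)]
    obtain a where a: "a \<in> A'" "a \<notin> A" "a \<notin> D"
      using irredundantE[OF irr, of A' A D] A'H neq by metis
    have vAD: "v \<in> A" "v \<in> D"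
      using AD(1) by blast+
    have av: "a < v"
      using precD[OF afP A'(1) AD(2) A'(2)] a vAD vA' neq by metis
    \<comment> \<open>The set \<open>V - D\<close> of \<open>F\<close> contains \<open>a\<close> and
      \<open>w\<close> but not \<open>v\<close>, while \<open>A\<close> contains \<open>v\<close>
      but neither \<open>a\<close> nor \<open>w\<close>.\<close>
    have no: False if w: "w \<notin> A" "w \<notin> D" "w \<in> V" "v < w" for w
      using alternation_freeD[OF af NF[OF AD(3)] _ av w(4), of A] a w vAD AD HV[OF A'H(1)]
      by (auto simp: P_def)
    have "\<not> prec A Y" if Y: "Y \<in> P" for Y
    proof
      assume AY: "prec A Y"
      have neY: "Y \<noteq> A" "Y \<noteq> D" "Y \<in> H"
        using Y AD AY HPN prec_asymp_on[OF afP irrP] by (auto dest: asymp_onD)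
      obtain w where w: "w \<in> Y" "w \<notin> A" "w \<notin> D"
        using irredundantE[OF irr, of Y A D] A'H neY by metis
      have "v < w"
        using precD[OF afP AD(2) Y AY] w vAD vn neY by metis
      then show False
        using no w HV neY by blast
    qed
    moreover have "\<not> prec D Y" if Y: "Y \<in> N" for Y
    proof
      assume DY: "prec D Y"
      have neY: "Y \<noteq> A" "Y \<noteq> D" "Y \<in> H"
        using Y AD DY HPN prec_asymp_on[OF afN irrN] by (auto dest: asymp_onD)
      obtain w where w: "w \<in> Y" "w \<notin> A" "w \<notin> D"
        using irredundantE[OF irr, of Y A D] A'H neY by metis
      have "v < w"
        using precD[OF afN AD(3) Y DY] w vAD vn neY by metis
      then show False
        using no w HV neY by blast
    qed
    ultimately show ?thesis by blast
  qed
  have "\<exists>X\<in>H. \<exists>Y\<in>H. v \<in> X \<and> v \<in> Y \<and> c X \<noteq> c Y" if v: "v \<in> V" "2 \<le> card {X \<in> H. v \<in> X}" for v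
  proof (cases "\<exists>X\<in>H. v \<in> X \<and> least X")
    case True
    then obtain X where X: "X \<in> H" "v \<in> X" "least X"
      by blast
    have "\<not> {X \<in> H. v \<in> X} \<subseteq> {X}"
      using v(2) card_mono[of "{X}" "{X \<in> H. v \<in> X}"] by auto
    then obtain Y where Y: "Y \<in> H" "v \<in> Y" "Y \<noteq> X"
      by blast
    then have "\<not> least Y"
      using X least_unique by blast
    then have "c X \<noteq> c Y"
      using X by (auto simp: c_def)
    then show ?thesis
      using X Y by blast
  next
    case nl: False
    have split: "{X \<in> H. v \<in> X} = {X \<in> P. v \<in> X} \<union> {X \<in> N. v \<in> X}"
      using HPN by auto
    then have sum: "card {X \<in> H. v \<in> X} = card {X \<in> P. v \<in> X} + card {X \<in> N. v \<in> X}"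
      using card_Un_disjoint[of "{X \<in> P. v \<in> X}" "{X \<in> N. v \<in> X}"] fin HPN by auto
    consider "2 \<le> card {X \<in> P. v \<in> X}" | "2 \<le> card {X \<in> N. v \<in> X}"
      | "card {X \<in> P. v \<in> X} = 1" "card {X \<in> N. v \<in> X} = 1"
      using sum v(2) by linarith
    then show ?thesis
    proof cases
      case 1
      then obtain X Y where XY: "X \<in> P" "Y \<in> P" "v \<in> X" "v \<in> Y"
        "rank P prec X mod 2 \<noteq> rank P prec Y mod 2"
        using prec_rank_parity[OF afP irrP fin(1) 1] by blast
      moreover have "X \<in> H" "Y \<in> H"
        using XY HPN by auto
      ultimately show ?thesis
        using nl by (intro bexI[of _ X] bexI[of _ Y]) (auto simp: c_def)
    next
      case 2
      then obtain X Y where XY: "X \<in> N" "Y \<in> N" "v \<in> X" "v \<in> Y"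
        "rank N prec X mod 2 \<noteq> rank N prec Y mod 2"
        using prec_rank_parity[OF afN irrN fin(2) 2] by blast
      have "X \<in> H" "Y \<in> H" "X \<notin> P" "Y \<notin> P"
        using XY HPN by auto
      moreover have "Suc (rank N prec X) mod 2 \<noteq> Suc (rank N prec Y) mod 2"
        using XY(5) by presburger
      ultimately show ?thesis
        using nl XY by (intro bexI[of _ X] bexI[of _ Y]) (auto simp: c_def)
    next
      case 3
      obtain A D where A: "{X \<in> P. v \<in> X} = {A}" and D: "{X \<in> N. v \<in> X} = {D}"
        using 3 by (meson card_1_singletonE)
      have AD: "{X \<in> H. v \<in> X} = {A, D}" "A \<in> P" "D \<in> N" "v \<in> A" "v \<in> D"
        using A D split by auto
      have AH: "A \<in> H" "D \<in> H" "D \<notin> P"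
        using AD HPN by auto
      have "\<not> least A" "\<not> least D"
        using nl AD AH by auto
      then have "c A = 0" "c D = 1"
        using greatest[OF v(1) AD(1-3)] AD AH by (auto simp: c_def rank_greatest)
      then show ?thesis
        using AD AH by (metis zero_neq_one)
    qed
  qed
  moreover have "c X < 3" for X
  proof -
    have "n mod 2 < 3" for n :: nat
      by presburger
    then show ?thesis
      by (simp add: c_def)
  qed
  ultimately show ?thesis
    by blast
qed

text \<open>Induction on the number of sets. A point of the removed set \<open>T\<close> also lies
  in \<open>X\<close> or \<open>Y\<close>, from which \<open>T\<close> differs in color; a point
  outside \<open>T\<close> lies in the same sets as before the removal.\<close>

lemma dual_coloring:
  assumes af: "alternation_free F" and FV: "F \<subseteq> Pow V" and "finite H"
    and "H \<subseteq> F \<union> complement_family V F"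
  shows "\<exists>c. c ` H \<subseteq> {..<3::nat} \<and>
    (\<forall>v\<in>V. 2 \<le> card {X \<in> H. v \<in> X} \<longrightarrow> (\<exists>X\<in>H. \<exists>Y\<in>H. v \<in> X \<and> v \<in> Y \<and> c X \<noteq> c Y))"
  using assms(3,4)
proof (induction "card H" arbitrary: H rule: less_induct)
  case less
  show ?case
  proof (cases "irredundant H")
    case True
    then show ?thesis
      using irredundant_coloring[OF af FV] less.prems by blast
  next
    case False
    then obtain T X Y where T: "T \<in> H" "X \<in> H - {T}" "Y \<in> H - {T}" "T \<subseteq> X \<union> Y"
      unfolding irredundant_def by blast
    let ?H = "H - {T}"
    have "card ?H < card H"
      using less.prems(1) T(1) by (rule card_Diff1_less)
    then obtain c where c: "c ` ?H \<subseteq> {..<3::nat}" and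
      good: "\<forall>v\<in>V. 2 \<le> card {X \<in> ?H. v \<in> X} \<longrightarrow> (\<exists>X\<in>?H. \<exists>Y\<in>?H. v \<in> X \<and> v \<in> Y \<and> c X \<noteq> c Y)"
      using less.hyps[of ?H] less.prems by blast
    have "card {c X, c Y} < card {..<3::nat}"
      by (simp add: card_insert_if)
    then obtain k where k: "k < 3" "k \<noteq> c X" "k \<noteq> c Y"
      by (metis card_mono finite.emptyI finite_insert insertCI lessThan_iff not_le subsetI)
    let ?c = "c(T := k)"
    have "\<exists>X\<in>H. \<exists>Y\<in>H. v \<in> X \<and> v \<in> Y \<and> ?c X \<noteq> ?c Y" if v: "v \<in> V" "2 \<le> card {X \<in> H. v \<in> X}" for v
    proof (cases "v \<in> T")
      case True
      then obtain Z where "Z = X \<or> Z = Y" "v \<in> Z"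
        using T by blast
      then show ?thesis
        using True T k by (intro bexI[of _ T] bexI[of _ Z]) auto
    next
      case False
      then have "{X \<in> ?H. v \<in> X} = {X \<in> H. v \<in> X}"
        by auto
      then obtain X Y where "X \<in> ?H" "Y \<in> ?H" "v \<in> X" "v \<in> Y" "c X \<noteq> c Y"
        using bspec[OF good v(1)] v(2) by auto
      then show ?thesis
        by (intro bexI[of _ X] bexI[of _ Y]) auto
    qed
    moreover have "?c ` H \<subseteq> {..<3}"
      using c k by auto
    ultimately show ?thesis
      by blast
  qed
qed

lemma dual_pseudohalfplane_proper_coloring:
  fixes G :: "'b hypergraph"
  assumes "dual_pseudohalfplane_hypergraph TYPE('a::linorder) G"
  shows "\<exists>c. proper_coloring 3 G c"
proof -
  obtain Q :: "'a hypergraph" where Q: "pseudohalfplane_hypergraph Q"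
    and iso: "hypergraph_isomorphic G (dual_hypergraph Q)"
    using assms unfolding dual_pseudohalfplane_hypergraph_def by blast
  obtain V H where VH: "Q = (V, H)"
    by fastforce
  obtain F where af: "alternation_free F" and FV: "F \<subseteq> Pow V" and fin: "finite V"
    and H: "H \<subseteq> F \<union> complement_family V F"
    using Q VH by (auto simp: pseudohalfplane_hypergraph_def ABA_free_iff hypergraph_def)
  have "H \<subseteq> Pow V"
    using H FV by (auto simp: complement_family_def)
  then have finH: "finite H"
    using fin by (simp add: finite_subset)
  obtain c where c: "c ` H \<subseteq> {..<3::nat}" and
    good: "\<forall>v\<in>V. 2 \<le> card {X \<in> H. v \<in> X} \<longrightarrow> (\<exists>X\<in>H. \<exists>Y\<in>H. v \<in> X \<and> v \<in> Y \<and> c X \<noteq> c Y)"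
    using dual_coloring[OF af FV finH H] by (elim exE conjE)
  obtain f where f: "bij_betw f (verts G) H"
    and edges: "(\<lambda>E. f ` E) ` hyperedges G = {{X \<in> H. v \<in> X} | v. v \<in> V}"
    and hG: "hypergraph G"
    using iso unfolding hypergraph_isomorphic_def dual_hypergraph_def VH by auto
  have "\<not> (\<exists>i. \<forall>e\<in>E. (c \<circ> f) e = i)" if E: "E \<in> hyperedges G" "2 \<le> card E" for E
  proof -
    obtain v where v: "v \<in> V" "f ` E = {X \<in> H. v \<in> X}"
      using imageI[OF E(1), of "\<lambda>E. f ` E"] unfolding edges by (elim CollectE exE conjE)
    have "E \<subseteq> verts G"
      using hG E by (auto simp: hypergraph_def)
    \<comment> \<open>Injectivity of \<open>f\<close> preserves the size of the edge, so at least
      two sets contain \<open>v\<close>.\<close>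
    then have "card (f ` E) = card E"
      using f by (meson bij_betw_def card_image inj_on_subset)
    then obtain X Y where "X \<in> f ` E" "Y \<in> f ` E" "c X \<noteq> c Y"
      using bspec[OF good v(1)] E(2) v(2) by auto
    then show ?thesis
      by (metis comp_apply imageE)
  qed
  moreover have "(c \<circ> f) ` verts G \<subseteq> {..<3}"
    using c f by (auto simp: bij_betw_def)
  ultimately have "proper_coloring 3 G (c \<circ> f)"
    unfolding proper_coloring_def by blast
  then show ?thesis
    by blast
qed

subsection \<open>Complete graphs\<close>

lemma chromatic_number_le: "\<exists>c. proper_coloring k G c \<Longrightarrow> chromatic_number G \<le> k"
  unfolding chromatic_number_def by (rule Least_le)

lemma proper_coloring_chromatic_number:
  assumes "\<exists>c. proper_coloring k G c"
  shows "\<exists>c. proper_coloring (chromatic_number G) G c"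
  unfolding chromatic_number_def using assms by (rule LeastI)

text \<open>The first assumption ensures that the minimum is attained by a coloring, and a proper
  coloring is injective when all pairs are edges.\<close>

lemma card_le_chromatic_number:
  assumes "\<exists>c. proper_coloring k G c" and fin: "finite (verts G)"
    and pairs: "\<And>x y. x \<in> verts G \<Longrightarrow> y \<in> verts G \<Longrightarrow> x \<noteq> y \<Longrightarrow> {x, y} \<in> hyperedges G"
  shows "card (verts G) \<le> chromatic_number G"
proof -
  obtain c where c: "proper_coloring (chromatic_number G) G c"
    using proper_coloring_chromatic_number[OF assms(1)] by blast
  have "inj_on c (verts G)"
  proof (rule inj_onI, rule ccontr)
    fix x y assume xy: "x \<in> verts G" "y \<in> verts G" "c x = c y" "x \<noteq> y"
    then have "{x, y} \<in> hyperedges G" "2 \<le> card {x, y}"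
      using pairs by auto
    then show False
      using c xy unfolding proper_coloring_def by blast
  qed
  then have "card (verts G) \<le> card {..<chromatic_number G}"
    using c unfolding proper_coloring_def by (intro card_inj_on_le) auto
  then show ?thesis by simp
qed

section \<open>Examples that attain the bounds\<close>

definition triangle :: "nat hypergraph" where
  "triangle = ({0, 1, 2}, {{0, 1}, {0, 2}, {1, 2}})"

lemma triangle_ABA_free: "ABA_free triangle"
  by (auto simp: ABA_free_def hypergraph_def triangle_def)

lemma triangle_chromatic_number: "chromatic_number triangle = 3"
proof (rule antisym)
  show "chromatic_number triangle \<le> 3"
    by (intro chromatic_number_le ABA_free_proper_coloring triangle_ABA_free)
  have "card (verts triangle) \<le> chromatic_number triangle"
    by (rule card_le_chromatic_number[OF ABA_free_proper_coloring[OF triangle_ABA_free]])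
      (auto simp: triangle_def insert_commute)
  then show "3 \<le> chromatic_number triangle"
    by (simp add: triangle_def)
qed

text \<open>The triangle is self-dual: \<open>f\<close> sends each vertex to the opposite edge, and
  thus the edge between two vertices to the pair of edges through the third.\<close>

lemma triangle_dual: "dual_pseudohalfplane_hypergraph TYPE(nat) triangle"
proof -
  define f :: "nat \<Rightarrow> nat set" where "f i = {0, 1, 2} - {i}" for i
  have f: "f 0 = {1, 2}" "f (Suc 0) = {0, 2}" "f 2 = {0, 1}"
    by (auto simp: f_def)
  have ne: "{0, 1} \<noteq> {0, 2::nat}" "{0, 1} \<noteq> {1, 2::nat}" "{0, 2} \<noteq> {1, 2::nat}"
    by (simp_all add: doubleton_eq_iff)
  have "pseudohalfplane_hypergraph triangle"
    unfolding pseudohalfplane_hypergraph_def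
    using triangle_ABA_free by (intro exI[of _ "hyperedges triangle"]) auto
  moreover have "hypergraph_isomorphic triangle (dual_hypergraph triangle)"
    unfolding hypergraph_isomorphic_def
  proof (intro conjI exI[of _ f])
    show "hypergraph triangle"
      using triangle_ABA_free by (simp add: ABA_free_def)
    show "hypergraph (dual_hypergraph triangle)"
      by (auto simp: hypergraph_def dual_hypergraph_def triangle_def)
    show "bij_betw f (verts triangle) (verts (dual_hypergraph triangle))"
      using ne by (auto simp: bij_betw_def inj_on_def dual_hypergraph_def triangle_def f)
    have *: "{X \<in> hyperedges triangle. 0 \<in> X} = {{0, 1}, {0, 2}}"
      "{X \<in> hyperedges triangle. 1 \<in> X} = {{0, 1}, {1, 2}}"
      "{X \<in> hyperedges triangle. 2 \<in> X} = {{0, 2}, {1, 2}}"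
      by (auto simp: triangle_def)
    have "hyperedges (dual_hypergraph triangle)
        = (\<lambda>v. {X \<in> hyperedges triangle. v \<in> X}) ` {0, 1, 2}"
      by (auto simp: dual_hypergraph_def triangle_def)
    also have "\<dots> = {{{0, 1}, {0, 2}}, {{0, 1}, {1, 2}}, {{0, 2}, {1, 2}}}"
      using * by simp
    also have "\<dots> = (\<lambda>E. f ` E) ` hyperedges triangle"
      by (simp add: triangle_def f insert_commute)
    finally show "hyperedges (dual_hypergraph triangle) = (\<lambda>E. f ` E) ` hyperedges triangle" .
  qed
  ultimately show ?thesis
    unfolding dual_pseudohalfplane_hypergraph_def by blast
qed

text \<open>Two of these edges differ in one vertex each, too few for an alternation. Their
  complements in four vertices are the other three edges of the complete graph.\<close>

definition star :: "nat set set" where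
  "star = {{0, 1}, {0, 2}, {0, 3}}"

definition K4 :: "nat hypergraph" where
  "K4 = ({0, 1, 2, 3}, star \<union> complement_family {0, 1, 2, 3} star)"

lemma K4_pseudohalfplane: "pseudohalfplane_hypergraph K4"
proof -
  have "ABA_free ({0, 1, 2, 3}, star)"
    by (auto simp: ABA_free_def hypergraph_def star_def)
  then show ?thesis
    unfolding pseudohalfplane_hypergraph_def K4_def by (intro exI[of _ star]) simp
qed

lemma K4_chromatic_number: "chromatic_number K4 = 4"
proof (rule antisym)
  show "chromatic_number K4 \<le> 4"
    by (intro chromatic_number_le pseudohalfplane_proper_coloring K4_pseudohalfplane)
  have "complement_family {0, 1, 2, 3} star = {{2, 3}, {1, 3}, {1, 2}}"
  proof -
    have "complement_family {0, 1, 2, 3} star = (\<lambda>A. {0, 1, 2, 3} - A) ` star"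
      by (auto simp: complement_family_def)
    then show ?thesis
      by (auto simp: star_def insert_Diff_if)
  qed
  then have K4_eq: "K4 = ({0, 1, 2, 3}, {{0, 1}, {0, 2}, {0, 3}, {2, 3}, {1, 3}, {1, 2}})"
    by (auto simp: K4_def star_def)
  have "{x, y} \<in> hyperedges K4" if "x \<in> verts K4" "y \<in> verts K4" "x \<noteq> y" for x y
    using that unfolding K4_eq by (auto simp: doubleton_eq_iff)
  then have "card (verts K4) \<le> chromatic_number K4"
    by (intro card_le_chromatic_number[OF pseudohalfplane_proper_coloring[OF K4_pseudohalfplane]])
      (auto simp: K4_def)
  then show "4 \<le> chromatic_number K4"
    by (simp add: K4_def)
qed

theorem mainTheorem10:
  shows "(\<forall>G :: 'a::linorder hypergraph. ABA_free G \<longrightarrow> chromatic_number G \<le> 3) \<and>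
    (\<forall>G :: 'a hypergraph. pseudohalfplane_hypergraph G \<longrightarrow> chromatic_number G \<le> 4) \<and>
    (\<forall>G :: 'b hypergraph. dual_pseudohalfplane_hypergraph TYPE('a) G \<longrightarrow> chromatic_number G \<le> 3) \<and>
    (\<exists>G :: nat hypergraph. ABA_free G \<and> chromatic_number G = 3) \<and>
    (\<exists>G :: nat hypergraph. dual_pseudohalfplane_hypergraph TYPE(nat) G \<and> chromatic_number G = 3) \<and>
    (\<exists>G :: nat hypergraph. pseudohalfplane_hypergraph G \<and> chromatic_number G = 4)"
  using ABA_free_proper_coloring pseudohalfplane_proper_coloring
    dual_pseudohalfplane_proper_coloring triangle_ABA_free triangle_dual triangle_chromatic_number
    K4_pseudohalfplane K4_chromatic_number
  by (intro conjI allI impI chromatic_number_le) blast+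

end
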